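(* For every $\rho\ge 1$, there is no randomized or deterministic $\rho$-competitive online algorithm for non-linear paging, even when restricted to instances with cache threshold $k=0$ and feasibility function $f$ taking values only in $\{0,1\}$.
   Context: Non-linear paging: a finite set $\mathcal{P}$ of pages, each page $p$ with eviction cost $c(p)\ge 0$; a monotone feasibility function $f:2^{\mathcal{P}}\to\mathbb{N}$ ($S'\subseteq S\Rightarrow f(S')\le f(S)$); a cache threshold $k$ with $f(\{p\})\le k$ for every page $p$. The cache is initially empty; requests $p_t\in\mathcal{P}$ arrive online at times $t=1,2,\dots$; at time $t$, if $p_t$ is not in the cache it is fetched, and the algorithm may evict pages (other than $p_t$) so that the set $S_t$ of pages in the cache afterwards satisfies $f(S_t)\le k$; the cost is the sum of eviction costs. An online algorithm is $\rho$-competitive if on every request sequence its (expected) cost is at most $\rho$ times the optimal offline cost. *)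

theory Defs
  imports "HOL-Probability.Probability"
begin

record 'p paging_instance =
  pages :: "'p set"
  evict_cost :: "'p \<Rightarrow> real"
  feas :: "'p set \<Rightarrow> nat"
  threshold :: nat

definition nonlinear_paging :: "'p paging_instance \<Rightarrow> bool" where
  "nonlinear_paging I \<longleftrightarrow>
     finite (pages I) \<and>
     (\<forall>p\<in>pages I. 0 \<le> evict_cost I p) \<and>
     (\<forall>S S'. S' \<subseteq> S \<longrightarrow> S \<subseteq> pages I \<longrightarrow> feas I S' \<le> feas I S) \<and>
     (\<forall>p\<in>pages I. feas I {p} \<le> threshold I)"

definition zero_one_instances :: "'p paging_instance set" where
  "zero_one_instances =
     {I. nonlinear_paging I \<and> threshold I = 0 \<and> (\<forall>S. S \<subseteq> pages I \<longrightarrow> feas I S \<in> {0, 1})}"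

text \<open>
  \<open>S t\<close> is the cache after the first \<open>t\<close> requests. Lists are indexed from 0, so
  \<open>\<sigma> ! t\<close> is the request at time \<open>Suc t\<close>; it is served by fetching it (if absent) and evicting
  \<open>insert (\<sigma> ! t) (S t) - S (Suc t)\<close>. Only the values of \<open>S\<close> up to \<open>length \<sigma>\<close> matter.
\<close>

definition schedule :: "'p paging_instance \<Rightarrow> 'p list \<Rightarrow> (nat \<Rightarrow> 'p set) \<Rightarrow> bool" where
  "schedule I \<sigma> S \<longleftrightarrow>
     S 0 = {} \<and>
     (\<forall>t<length \<sigma>. \<sigma> ! t \<in> S (Suc t) \<and> S (Suc t) \<subseteq> insert (\<sigma> ! t) (S t) \<and>
        feas I (S (Suc t)) \<le> threshold I)"

definition schedule_cost :: "'p paging_instance \<Rightarrow> 'p list \<Rightarrow> (nat \<Rightarrow> 'p set) \<Rightarrow> real" where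
  "schedule_cost I \<sigma> S =
     (\<Sum>t<length \<sigma>. \<Sum>p\<in>insert (\<sigma> ! t) (S t) - S (Suc t). evict_cost I p)"

definition opt_cost :: "'p paging_instance \<Rightarrow> 'p list \<Rightarrow> real" where
  "opt_cost I \<sigma> = Inf {schedule_cost I \<sigma> S |S. schedule I \<sigma> S}"

text \<open>
  A deterministic online policy maps the requests seen so far to the current cache.
\<close>

definition run :: "('p list \<Rightarrow> 'p set) \<Rightarrow> 'p list \<Rightarrow> nat \<Rightarrow> 'p set" where
  "run a \<sigma> t = a (take t \<sigma>)"

definition online_policy :: "'p paging_instance \<Rightarrow> ('p list \<Rightarrow> 'p set) \<Rightarrow> bool" where
  "online_policy I a \<longleftrightarrow> (\<forall>\<sigma>\<in>lists (pages I). schedule I \<sigma> (run a \<sigma>))"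

text \<open>
  An algorithm knows the whole instance in advance; only the requests are revealed online.
  A randomized algorithm is a random deterministic one: on instance \<open>I\<close> it draws a seed \<open>\<omega>\<close> from
  the probability space \<open>M I\<close> and follows the policy \<open>A I \<omega>\<close>. The requests do not depend on \<open>\<omega>\<close>,
  i.e. the adversary is oblivious. Measurability makes the cost on each request sequence a
  bounded random variable, so that the expectation is meaningful.
\<close>

definition deterministic_alg ::
    "'p paging_instance set \<Rightarrow> ('p paging_instance \<Rightarrow> 'p list \<Rightarrow> 'p set) \<Rightarrow> bool" where
  "deterministic_alg C A \<longleftrightarrow> (\<forall>I\<in>C. online_policy I (A I))"

definition deterministic_competitive ::
    "'p paging_instance set \<Rightarrow> real \<Rightarrow> ('p paging_instance \<Rightarrow> 'p list \<Rightarrow> 'p set) \<Rightarrow> bool" where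
  "deterministic_competitive C \<rho> A \<longleftrightarrow>
     (\<forall>I\<in>C. \<forall>\<sigma>\<in>lists (pages I). schedule_cost I \<sigma> (run (A I) \<sigma>) \<le> \<rho> * opt_cost I \<sigma>)"

definition randomized_alg ::
    "'p paging_instance set \<Rightarrow> ('p paging_instance \<Rightarrow> 'w measure) \<Rightarrow>
     ('p paging_instance \<Rightarrow> 'w \<Rightarrow> 'p list \<Rightarrow> 'p set) \<Rightarrow> bool" where
  "randomized_alg C M A \<longleftrightarrow>
     (\<forall>I\<in>C. prob_space (M I) \<and>
        (\<forall>\<omega>\<in>space (M I). online_policy I (A I \<omega>)) \<and>
        (\<forall>\<sigma>\<in>lists (pages I). (\<lambda>\<omega>. A I \<omega> \<sigma>) \<in> measurable (M I) (count_space (Pow (pages I)))))"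

definition randomized_competitive ::
    "'p paging_instance set \<Rightarrow> real \<Rightarrow> ('p paging_instance \<Rightarrow> 'w measure) \<Rightarrow>
     ('p paging_instance \<Rightarrow> 'w \<Rightarrow> 'p list \<Rightarrow> 'p set) \<Rightarrow> bool" where
  "randomized_competitive C \<rho> M A \<longleftrightarrow>
     (\<forall>I\<in>C. \<forall>\<sigma>\<in>lists (pages I).
        (\<integral>\<omega>. schedule_cost I \<sigma> (run (A I \<omega>) \<sigma>) \<partial>M I) \<le> \<rho> * opt_cost I \<sigma>)"

end

theory Submission
  imports Defs
begin

text \<open>
  Take \<open>n\<close> pages \<open>A\<close> of unit cost and, for every nonempty \<open>T \<subseteq> A\<close>, a free page \<open>c T\<close> that cannot
  share the cache with all of \<open>T\<close>. Request all of \<open>A\<close>, then \<open>c T\<close> for a chain \<open>T = T\<^sub>n, \<dots>, T\<^sub>1\<close>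
  with \<open>|T\<^sub>m| = m\<close>. After the request \<open>c T\<^sub>m\<close> some page of \<open>T\<^sub>m\<close> is missing, so one of them is
  missing with probability at least \<open>1/m\<close>; the adversary, who knows the distribution of the
  algorithm, obtains the next set of the chain by dropping such a page. Pages of \<open>A\<close> are never
  requested again, so the expected number of evictions is at least the harmonic number \<open>H\<^sub>n\<close>,
  whereas evicting the last remaining page right away costs 1.
\<close>

section \<open>Online policies\<close>

lemma online_policy_Nil: "online_policy I a \<Longrightarrow> a [] = {}"
  unfolding online_policy_def schedule_def run_def by (metis lists.Nil take0)

lemma online_policy_snoc:
  assumes "online_policy I a" "\<sigma> \<in> lists (pages I)" "p \<in> pages I"
  shows "p \<in> a (\<sigma> @ [p])" "a (\<sigma> @ [p]) \<subseteq> insert p (a \<sigma>)" "feas I (a (\<sigma> @ [p])) \<le> threshold I"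
proof -
  have "schedule I (\<sigma> @ [p]) (run a (\<sigma> @ [p]))"
    using assms by (auto simp: online_policy_def)
  then have "(\<sigma> @ [p]) ! length \<sigma> \<in> run a (\<sigma> @ [p]) (Suc (length \<sigma>)) \<and>
      run a (\<sigma> @ [p]) (Suc (length \<sigma>)) \<subseteq> insert ((\<sigma> @ [p]) ! length \<sigma>) (run a (\<sigma> @ [p]) (length \<sigma>)) \<and>
      feas I (run a (\<sigma> @ [p]) (Suc (length \<sigma>))) \<le> threshold I"
    unfolding schedule_def by (metis length_append_singleton lessI)
  then show "p \<in> a (\<sigma> @ [p])" "a (\<sigma> @ [p]) \<subseteq> insert p (a \<sigma>)" "feas I (a (\<sigma> @ [p])) \<le> threshold I"
    by (simp_all add: run_def)
qed

text \<open>A page enters the cache only when it is requested. Hence an absent page stays absent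
  until its next request, which lets losses accumulate along the chain.\<close>

lemma online_policy_append_subset:
  assumes "online_policy I a" "\<sigma> \<in> lists (pages I)" "\<tau> \<in> lists (pages I)"
  shows "a (\<sigma> @ \<tau>) \<subseteq> a \<sigma> \<union> set \<tau>"
  using assms(3)
proof (induction \<tau> rule: rev_induct)
  case Nil
  then show ?case by simp
next
  case (snoc p \<tau>)
  have "a (\<sigma> @ \<tau> @ [p]) \<subseteq> insert p (a (\<sigma> @ \<tau>))"
    using online_policy_snoc(2)[of I a "\<sigma> @ \<tau>" p] assms(1,2) snoc.prems by simp
  with snoc show ?case by auto
qed

lemma online_policy_subset:
  assumes "online_policy I a" "\<sigma> \<in> lists (pages I)"
  shows "a \<sigma> \<subseteq> set \<sigma>"
  using online_policy_append_subset[OF assms(1) _ assms(2), of "[]"] online_policy_Nil[OF assms(1)]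
  by simp

lemma schedule_cost_run_snoc:
  "schedule_cost I (\<sigma> @ [p]) (run a (\<sigma> @ [p])) =
     schedule_cost I \<sigma> (run a \<sigma>) + sum (evict_cost I) (insert p (a \<sigma>) - a (\<sigma> @ [p]))"
  unfolding schedule_cost_def run_def by (simp add: nth_append)

text \<open>Each requested page was fetched, so its absence means that it has been evicted; one
  eviction per absent page is charged.\<close>

lemma schedule_cost_run_ge:
  assumes "nonlinear_paging I" "online_policy I a" "\<sigma> \<in> lists (pages I)"
  shows "sum (evict_cost I) (set \<sigma> - a \<sigma>) \<le> schedule_cost I \<sigma> (run a \<sigma>)"
  using assms(3)
proof (induction \<sigma> rule: rev_induct)
  case Nil
  then show ?case by (simp add: schedule_cost_def)
next
  case (snoc p \<sigma>)
  let ?X = "set \<sigma> - a \<sigma>" and ?Y = "insert p (a \<sigma>) - a (\<sigma> @ [p])"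
  have sub: "a \<sigma> \<subseteq> set \<sigma>" "set \<sigma> \<subseteq> pages I" "p \<in> pages I"
    using online_policy_subset[OF assms(2), of \<sigma>] snoc.prems by auto
  then have fin: "finite (a \<sigma>)"
    by (meson List.finite_set finite_subset)
  have nonneg: "\<And>x. x \<in> pages I \<Longrightarrow> 0 \<le> evict_cost I x"
    using assms(1) by (simp add: nonlinear_paging_def)
  \<comment> \<open>A page missing now was either missing before this request or is evicted by
    it.\<close>
  have "sum (evict_cost I) (set (\<sigma> @ [p]) - a (\<sigma> @ [p])) \<le> sum (evict_cost I) (?X \<union> ?Y)"
    using sub fin by (intro sum_mono2) (auto intro: nonneg)
  also have "\<dots> \<le> sum (evict_cost I) ?X + sum (evict_cost I) ?Y"
    using sub fin by (subst sum_Un) (auto intro!: sum_nonneg nonneg)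
  finally show ?case
    using snoc by (simp add: schedule_cost_run_snoc)
qed

section \<open>Expected cost of a randomized policy\<close>

text \<open>All that the adversary uses about the algorithm. These numbers do not depend on the seed
  drawn, so requests chosen from them are oblivious.\<close>

definition missing_prob :: "'w measure \<Rightarrow> ('w \<Rightarrow> 'p list \<Rightarrow> 'p set) \<Rightarrow> 'p list \<Rightarrow> 'p \<Rightarrow> real" where
  "missing_prob M a \<sigma> x = measure M {\<omega> \<in> space M. x \<notin> a \<omega> \<sigma>}"

locale randomized_policy = prob_space M for M :: "'w measure" +
  fixes I :: "'p paging_instance" and a :: "'w \<Rightarrow> 'p list \<Rightarrow> 'p set"
  assumes paging: "nonlinear_paging I"
    and policy: "\<And>\<omega>. \<omega> \<in> space M \<Longrightarrow> online_policy I (a \<omega>)"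
    and measurable_cache: "\<And>\<sigma>. \<sigma> \<in> lists (pages I) \<Longrightarrow>
          (\<lambda>\<omega>. a \<omega> \<sigma>) \<in> measurable M (count_space (Pow (pages I)))"
begin

text \<open>Finitely many pages leave finitely many possible caches, so every real function of the
  cache becomes integrable.\<close>

lemma simple_function_cache:
  assumes "\<sigma> \<in> lists (pages I)"
  shows "simple_function M (\<lambda>\<omega>. a \<omega> \<sigma>)"
proof -
  have "finite (Pow (pages I))"
    using paging by (simp add: nonlinear_paging_def)
  moreover have "(\<lambda>\<omega>. a \<omega> \<sigma>) ` space M \<subseteq> Pow (pages I)"
    using measurable_cache[OF assms] by (auto simp: measurable_def)
  moreover have "(\<lambda>\<omega>. a \<omega> \<sigma>) -` {X} \<inter> space M \<in> sets M" if "X \<in> Pow (pages I)" for X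
    using measurable_sets[OF measurable_cache[OF assms], of "{X}"] that by simp
  ultimately show ?thesis
    unfolding simple_function_def by (meson finite_subset subset_iff)
qed

lemma missing_event:
  assumes "\<sigma> \<in> lists (pages I)"
  shows "{\<omega> \<in> space M. x \<notin> a \<omega> \<sigma>} \<in> events"
proof -
  have "{\<omega> \<in> space M. x \<notin> a \<omega> \<sigma>} = (\<lambda>\<omega>. a \<omega> \<sigma>) -` {X. x \<notin> X} \<inter> space M"
    by auto
  also have "\<dots> \<in> events"
    by (rule simple_functionD(2)[OF simple_function_cache[OF assms]])
  finally show ?thesis .
qed

lemma simple_function_integrable:
  fixes f :: "'w \<Rightarrow> real"
  assumes "simple_function M f"
  shows "integrable M f"
proof -
  have "bounded (f ` space M)"
    using simple_functionD(1)[OF assms] by (rule finite_imp_bounded)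
  then obtain B where "\<And>\<omega>. \<omega> \<in> space M \<Longrightarrow> norm (f \<omega>) \<le> B"
    by (auto simp: bounded_iff)
  then show ?thesis
    using assms by (intro integrable_const_bound[of _ B]) (auto intro: borel_measurable_simple_function)
qed

text \<open>The seed enters each summand only through two consecutive caches, which are simple
  functions.\<close>

lemma integrable_cost:
  assumes "\<sigma> \<in> lists (pages I)"
  shows "integrable M (\<lambda>\<omega>. schedule_cost I \<sigma> (run (a \<omega>) \<sigma>))"
  unfolding schedule_cost_def run_def
proof (rule Bochner_Integration.integrable_sum, rule simple_function_integrable)
  fix t
  have "take k \<sigma> \<in> lists (pages I)" for k
    using assms by (auto dest: in_set_takeD)
  then show "simple_function M
      (\<lambda>\<omega>. sum (evict_cost I) (insert (\<sigma> ! t) (a \<omega> (take t \<sigma>)) - a \<omega> (take (Suc t) \<sigma>)))"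
    using simple_function_compose2[of M "\<lambda>\<omega>. a \<omega> (take t \<sigma>)" "\<lambda>\<omega>. a \<omega> (take (Suc t) \<sigma>)"
        "\<lambda>X Y. sum (evict_cost I) (insert (\<sigma> ! t) X - Y)"] simple_function_cache
    by blast
qed

lemma missing_integral:
  assumes "\<sigma> \<in> lists (pages I)" "finite A"
  shows "integrable M (\<lambda>\<omega>. \<Sum>x\<in>A. indicator {\<omega> \<in> space M. x \<notin> a \<omega> \<sigma>} \<omega> :: real)"
    and "(\<integral>\<omega>. (\<Sum>x\<in>A. indicator {\<omega> \<in> space M. x \<notin> a \<omega> \<sigma>} \<omega>) \<partial>M) = (\<Sum>x\<in>A. missing_prob M a \<sigma> x)"
proof -
  have *: "integrable M (indicator {\<omega> \<in> space M. x \<notin> a \<omega> \<sigma>} :: 'w \<Rightarrow> real)" for x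
    using missing_event[OF assms(1)] by (simp add: emeasure_eq_measure)
  then show "integrable M (\<lambda>\<omega>. \<Sum>x\<in>A. indicator {\<omega> \<in> space M. x \<notin> a \<omega> \<sigma>} \<omega> :: real)"
    by (intro Bochner_Integration.integrable_sum)
  have "{\<omega> \<in> space M. x \<notin> a \<omega> \<sigma>} \<inter> space M = {\<omega> \<in> space M. x \<notin> a \<omega> \<sigma>}" for x
    by auto
  then show "(\<integral>\<omega>. (\<Sum>x\<in>A. indicator {\<omega> \<in> space M. x \<notin> a \<omega> \<sigma>} \<omega>) \<partial>M) = (\<Sum>x\<in>A. missing_prob M a \<sigma> x)"
    using * by (subst Bochner_Integration.integral_sum) (auto simp: missing_prob_def)
qed

lemma missing_prob_append_mono:
  assumes "\<sigma> \<in> lists (pages I)" "\<tau> \<in> lists (pages I)" "x \<notin> set \<tau>"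
  shows "missing_prob M a \<sigma> x \<le> missing_prob M a (\<sigma> @ \<tau>) x"
  unfolding missing_prob_def
proof (rule finite_measure_mono)
  show "{\<omega> \<in> space M. x \<notin> a \<omega> (\<sigma> @ \<tau>)} \<in> events"
    using assms by (intro missing_event) simp
  show "{\<omega> \<in> space M. x \<notin> a \<omega> \<sigma>} \<subseteq> {\<omega> \<in> space M. x \<notin> a \<omega> (\<sigma> @ \<tau>)}"
    using online_policy_append_subset[OF policy assms(1,2)] assms(3) by blast
qed

text \<open>By linearity the sum is the expected number of missing pages of \<open>T\<close>, and
  that number is at least 1 for every seed.\<close>

lemma sum_missing_prob_ge_1:
  assumes "\<sigma> \<in> lists (pages I)" "finite T" "\<And>\<omega>. \<omega> \<in> space M \<Longrightarrow> \<not> T \<subseteq> a \<omega> \<sigma>"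
  shows "1 \<le> (\<Sum>x\<in>T. missing_prob M a \<sigma> x)"
proof -
  have "(1 :: real) = (\<integral>\<omega>. 1 \<partial>M)"
    by (simp add: prob_space)
  also have "\<dots> \<le> (\<integral>\<omega>. (\<Sum>x\<in>T. indicator {\<omega> \<in> space M. x \<notin> a \<omega> \<sigma>} \<omega>) \<partial>M)"
  proof (rule integral_mono)
    fix \<omega> assume \<omega>: "\<omega> \<in> space M"
    then obtain x where x: "x \<in> T" "x \<notin> a \<omega> \<sigma>"
      using assms(3) by blast
    show "1 \<le> (\<Sum>x\<in>T. indicator {\<omega> \<in> space M. x \<notin> a \<omega> \<sigma>} \<omega> :: real)"
      using member_le_sum[of x T "\<lambda>x. indicator {\<omega> \<in> space M. x \<notin> a \<omega> \<sigma>} \<omega> :: real"] x \<omega> assms(2)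
      by simp
  qed (use missing_integral[OF assms(1,2)] in auto)
  finally show ?thesis
    by (simp add: missing_integral[OF assms(1,2)])
qed

text \<open>For each seed, the number of missing pages of \<open>A\<close> is bounded by the cost
  through \<open>schedule_cost_run_ge\<close>; then expectations are taken.\<close>

lemma expected_cost_ge:
  assumes "\<sigma> \<in> lists (pages I)" "A \<subseteq> set \<sigma>" "\<And>x. x \<in> A \<Longrightarrow> evict_cost I x = 1"
  shows "(\<Sum>x\<in>A. missing_prob M a \<sigma> x) \<le> (\<integral>\<omega>. schedule_cost I \<sigma> (run (a \<omega>) \<sigma>) \<partial>M)"
proof -
  have fin: "finite A"
    using assms(2) finite_subset by blast
  have "(\<integral>\<omega>. (\<Sum>x\<in>A. indicator {\<omega> \<in> space M. x \<notin> a \<omega> \<sigma>} \<omega>) \<partial>M)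
      \<le> (\<integral>\<omega>. schedule_cost I \<sigma> (run (a \<omega>) \<sigma>) \<partial>M)"
  proof (rule integral_mono)
    fix \<omega> assume \<omega>: "\<omega> \<in> space M"
    have "(\<Sum>x\<in>A. indicator {\<omega> \<in> space M. x \<notin> a \<omega> \<sigma>} \<omega>) = (\<Sum>x\<in>A. if x \<notin> a \<omega> \<sigma> then 1 else 0 :: real)"
      using \<omega> by (intro sum.cong) auto
    also have "\<dots> = (\<Sum>x\<in>A - a \<omega> \<sigma>. 1)"
      using fin by (intro sum.mono_neutral_cong_right) auto
    also have "\<dots> = sum (evict_cost I) (A - a \<omega> \<sigma>)"
      using assms(3) by (intro sum.cong) auto
    also have "\<dots> \<le> sum (evict_cost I) (set \<sigma> - a \<omega> \<sigma>)"
      using assms(1,2) paging by (intro sum_mono2) (auto simp: nonlinear_paging_def)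
    also have "\<dots> \<le> schedule_cost I \<sigma> (run (a \<omega>) \<sigma>)"
      using schedule_cost_run_ge[OF paging policy[OF \<omega>] assms(1)] .
    finally show "(\<Sum>x\<in>A. indicator {\<omega> \<in> space M. x \<notin> a \<omega> \<sigma>} \<omega>) \<le> schedule_cost I \<sigma> (run (a \<omega>) \<sigma>)" .
  qed (use missing_integral[OF assms(1) fin] integrable_cost[OF assms(1)] in auto)
  then show ?thesis
    by (simp add: missing_integral[OF assms(1) fin])
qed

end

section \<open>The lower bound instance\<close>

text \<open>With threshold 0, a cache is feasible iff it holds no \<open>c T\<close> together with
  all of \<open>T\<close>. The case \<open>T = {}\<close> is excluded because \<open>c {}\<close>
  would be infeasible on its own.\<close>

definition blocking_instance :: "'p set \<Rightarrow> ('p set \<Rightarrow> 'p) \<Rightarrow> 'p paging_instance" where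
  "blocking_instance A c =
     \<lparr>pages = A \<union> c ` (Pow A - {{}}),
      evict_cost = (\<lambda>p. if p \<in> A then 1 else 0),
      feas = (\<lambda>S. if \<exists>T\<subseteq>A. T \<noteq> {} \<and> c T \<in> S \<and> T \<subseteq> S then 1 else 0),
      threshold = 0\<rparr>"

lemma blocking_instance_simps [simp]:
  "pages (blocking_instance A c) = A \<union> c ` (Pow A - {{}})"
  "evict_cost (blocking_instance A c) p = (if p \<in> A then 1 else 0)"
  "feas (blocking_instance A c) S = (if \<exists>T\<subseteq>A. T \<noteq> {} \<and> c T \<in> S \<and> T \<subseteq> S then 1 else 0)"
  "threshold (blocking_instance A c) = 0"
  by (simp_all add: blocking_instance_def)

text \<open>Freshness keeps a blocker request from refetching a page of \<open>A\<close>;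
  injectivity recovers the blocked set from its blocker.\<close>

locale blocking =
  fixes A :: "'p set" and c :: "'p set \<Rightarrow> 'p"
  assumes finite_A: "finite A"
    and inj_c: "inj_on c (Pow A)"
    and c_notin: "\<And>T. T \<subseteq> A \<Longrightarrow> c T \<notin> A"
begin

lemma blocking_zero_one: "blocking_instance A c \<in> zero_one_instances"
proof -
  let ?I = "blocking_instance A c"
  define blocked where "blocked S \<longleftrightarrow> (\<exists>T\<subseteq>A. T \<noteq> {} \<and> c T \<in> S \<and> T \<subseteq> S)" for S
  have feas: "feas ?I S = (if blocked S then 1 else 0)" for S
    by (simp add: blocked_def)
  have "\<not> blocked {p}" for p
  proof
    assume "blocked {p}"
    \<comment> \<open>A nonempty \<open>T\<close> inside a singleton that also contains
      \<open>c T\<close> must be \<open>{c T}\<close>, which puts a blocker into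
      \<open>A\<close>.\<close>
    then obtain T where T: "T \<subseteq> A" "T = {c T}"
      unfolding blocked_def by blast
    then show False
      using c_notin[of T] by blast
  qed
  then have "feas ?I {p} = 0" for p
    unfolding feas by simp
  moreover have "blocked S" if "S' \<subseteq> S" "blocked S'" for S S'
    using that unfolding blocked_def by (meson subsetD order_trans)
  then have "feas ?I S' \<le> feas ?I S" if "S' \<subseteq> S" for S S'
    using that unfolding feas by simp
  moreover have "feas ?I S \<in> {0, 1}" for S
    by simp
  moreover have "finite (pages ?I)" "\<forall>p\<in>pages ?I. 0 \<le> evict_cost ?I p"
    using finite_A by simp_all
  ultimately show ?thesis
    unfolding zero_one_instances_def nonlinear_paging_def
    by (simp del: blocking_instance_simps(1,2,3))
qed

lemma blockers_subset_pages:
  "T \<subseteq> A \<Longrightarrow> c ` {U. U \<subseteq> T \<and> y \<in> U} \<subseteq> pages (blocking_instance A c)"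
  unfolding blocking_instance_simps by (intro le_supI2 image_mono) auto

text \<open>Every blocker in \<open>\<tau>\<close> blocks a set containing \<open>y\<close>, so the
  offline schedule evicts \<open>y\<close> at the first blocker request and keeps everything
  else.\<close>

lemma blocking_opt_cost_le_1:
  assumes "set xs = A" "y \<in> A" "\<tau> \<in> lists (c ` {T. T \<subseteq> A \<and> y \<in> T})"
  shows "opt_cost (blocking_instance A c) (xs @ \<tau>) \<le> 1"
proof -
  let ?I = "blocking_instance A c" and ?\<sigma> = "xs @ \<tau>"
  \<comment> \<open>\<open>S t\<close> is the cache after \<open>t\<close> requests, so
    \<open>y\<close> is still present at \<open>t = length xs\<close> and leaves while the first
    request of \<open>\<tau>\<close> is served.\<close>
  define S where "S t = set (take t ?\<sigma>) - (if t \<le> length xs then {} else {y})" for t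
  have take_xs: "set (take t ?\<sigma>) \<subseteq> A" if "t \<le> length xs" for t
    using that assms(1) by (auto dest: in_set_takeD)
  have take_\<sigma>: "set (take t ?\<sigma>) \<subseteq> A \<union> c ` {T. T \<subseteq> A \<and> y \<in> T}" for t
    using assms(1,3) by (force dest: in_set_takeD)
  have req: "?\<sigma> ! t \<noteq> y" if "t < length ?\<sigma>" "t \<ge> length xs" for t
  proof -
    have "?\<sigma> ! t \<in> set \<tau>"
      using that by (simp add: nth_append)
    then show ?thesis
      using assms(2,3) c_notin by auto
  qed
  have feas: "feas ?I (S t) = 0" for t
  proof -
    \<comment> \<open>During \<open>xs\<close> the cache contains no blocker. Later, injectivity
      shows that a cached \<open>c T\<close> has \<open>y\<close> in \<open>T\<close>, but
      \<open>y\<close> is gone.\<close>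
    have False if T: "T \<subseteq> A" "T \<noteq> {}" "c T \<in> S t" "T \<subseteq> S t" for T
    proof (cases "t \<le> length xs")
      case True
      then show False
        using T take_xs[of t] c_notin[of T] by (auto simp: S_def)
    next
      case False
      have "c T \<in> c ` {T. T \<subseteq> A \<and> y \<in> T}"
        using T take_\<sigma>[of t] c_notin[of T] by (auto simp: S_def)
      then have "y \<in> T"
        using T(1) inj_c by (auto dest: inj_onD)
      then show False
        using T(4) False by (auto simp: S_def)
    qed
    then show ?thesis
      by auto
  qed
  have "schedule ?I ?\<sigma> S"
    unfolding schedule_def
  proof (intro conjI allI impI)
    show "S 0 = {}"
      by (simp add: S_def)
    fix t assume t: "t < length ?\<sigma>"
    then have *: "set (take (Suc t) ?\<sigma>) = insert (?\<sigma> ! t) (set (take t ?\<sigma>))"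
      by (simp add: take_Suc_conv_app_nth del: take_append)
    show "?\<sigma> ! t \<in> S (Suc t)" "S (Suc t) \<subseteq> insert (?\<sigma> ! t) (S t)"
      using req[OF t] unfolding S_def * by auto
    show "feas ?I (S (Suc t)) \<le> threshold ?I"
      using feas by simp
  qed
  have "schedule_cost ?I ?\<sigma> S \<le> (\<Sum>t<length ?\<sigma>. if t = length xs then 1 else 0)"
    unfolding schedule_cost_def
  proof (rule sum_mono)
    fix t assume "t \<in> {..<length ?\<sigma>}"
    then have *: "set (take (Suc t) ?\<sigma>) = insert (?\<sigma> ! t) (set (take t ?\<sigma>))"
      by (simp add: take_Suc_conv_app_nth del: take_append)
    let ?E = "insert (?\<sigma> ! t) (S t) - S (Suc t)"
    have sub: "?E \<subseteq> (if t = length xs then {y} else {})"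
      using req[of t] \<open>t \<in> {..<length ?\<sigma>}\<close> unfolding S_def * by auto
    have "sum (evict_cost ?I) ?E \<le> sum (evict_cost ?I) (if t = length xs then {y} else {})"
      using sub by (intro sum_mono2) auto
    then show "sum (evict_cost ?I) ?E \<le> (if t = length xs then 1 else 0)"
      by (auto split: if_splits)
  qed
  also have "\<dots> \<le> 1"
    by simp
  finally have "schedule_cost ?I ?\<sigma> S \<le> 1" .
  moreover have "opt_cost ?I ?\<sigma> \<le> schedule_cost ?I ?\<sigma> S"
    unfolding opt_cost_def
  proof (rule cInf_lower)
    show "schedule_cost ?I ?\<sigma> S \<in> {schedule_cost ?I ?\<sigma> S |S. schedule ?I ?\<sigma> S}"
      using \<open>schedule ?I ?\<sigma> S\<close> by blast
    \<comment> \<open>A real \<open>Inf\<close> is a lower bound only for sets bounded below; here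
      costs are nonnegative.\<close>
    show "bdd_below {schedule_cost ?I ?\<sigma> S |S. schedule ?I ?\<sigma> S}"
      by (rule bdd_belowI[of _ 0]) (auto simp: schedule_cost_def intro!: sum_nonneg)
  qed
  ultimately show ?thesis
    by simp
qed

text \<open>Requesting \<open>c T\<close> forces some page \<open>x\<close> of \<open>T\<close> to
  be missing with probability at least \<open>1 / card T\<close>. The chain continues with
  \<open>T - {x}\<close>, after the prefix extended by \<open>c T\<close>, and contributes the
  remaining harmonic terms. The surviving page \<open>y\<close> lies in every set of the chain, as
  the offline schedule requires.\<close>

lemma blocking_chain:
  assumes "randomized_policy M (blocking_instance A c) a"
    and "T \<subseteq> A" "T \<noteq> {}" "\<sigma> \<in> lists (pages (blocking_instance A c))"
  shows "\<exists>\<tau> y. y \<in> T \<and> \<tau> \<in> lists (c ` {U. U \<subseteq> T \<and> y \<in> U}) \<and>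
           harm (card T) \<le> (\<Sum>x\<in>T. missing_prob M a (\<sigma> @ \<tau>) x)"
  using assms(2-)
proof (induction "card T" arbitrary: T \<sigma> rule: less_induct)
  case less
  let ?I = "blocking_instance A c" and ?\<sigma> = "\<sigma> @ [c T]"
  interpret randomized_policy M ?I a
    by fact
  have fin: "finite T"
    using less.prems(1) finite_A finite_subset by blast
  have \<sigma>: "?\<sigma> \<in> lists (pages ?I)"
    using less.prems by auto
  \<comment> \<open>\<open>c T\<close> was just requested and is cached, so feasibility rules out
    all of \<open>T\<close>.\<close>
  have "\<not> T \<subseteq> a \<omega> ?\<sigma>" if "\<omega> \<in> space M" for \<omega>
    using online_policy_snoc(1,3)[OF policy[OF that] less.prems(3), of "c T"] less.prems(1,2)
    by (auto split: if_splits)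
  then have "1 \<le> (\<Sum>x\<in>T. missing_prob M a ?\<sigma> x)"
    by (intro sum_missing_prob_ge_1 \<sigma> fin)
  moreover have "(\<Sum>x\<in>T. 1 / real (card T)) = 1"
    using fin less.prems(2) by simp
  \<comment> \<open>Averaging: if all these probabilities were below \<open>1 / card T\<close>,
    their sum would be below 1.\<close>
  ultimately obtain x where x: "x \<in> T" "1 / real (card T) \<le> missing_prob M a ?\<sigma> x"
    using sum_strict_mono[OF fin less.prems(2), of "missing_prob M a ?\<sigma>" "\<lambda>_. 1 / real (card T)"]
    by (metis less_le_not_le linorder_not_le)
  obtain m where m: "card T = Suc m" "card (T - {x}) = m"
    using x(1) fin by (metis card_Suc_Diff1)
  show ?case
  proof (cases "T - {x} = {}")
    case True
    then have "T = {x}"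
      using x(1) by blast
    then show ?thesis
      using x(2) by (intro exI[of _ "[c T]"] exI[of _ x]) (auto simp: harm_def)
  next
    case False
    obtain \<tau> y where \<tau>: "y \<in> T - {x}" "\<tau> \<in> lists (c ` {U. U \<subseteq> T - {x} \<and> y \<in> U})"
      "harm (card (T - {x})) \<le> (\<Sum>x\<in>T - {x}. missing_prob M a (?\<sigma> @ \<tau>) x)"
      using less.hyps[of "T - {x}" ?\<sigma>] less.prems(1) m False \<sigma> by auto
    have \<tau>_pages: "\<tau> \<in> lists (pages ?I)"
      using \<tau>(2) lists_mono[OF blockers_subset_pages[of "T - {x}" y]] less.prems(1) by blast
    have "x \<notin> set \<tau>"
    proof
      assume "x \<in> set \<tau>"
      then obtain U where "U \<subseteq> T - {x}" "x = c U"
        using \<tau>(2) by blast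
      then show False
        using c_notin[of U] x(1) less.prems(1) by blast
    qed
    \<comment> \<open>\<open>\<tau>\<close> requests blockers only, so \<open>x\<close> never
      returns and its term survives to the end.\<close>
    then have "1 / real (card T) \<le> missing_prob M a (?\<sigma> @ \<tau>) x"
      using missing_prob_append_mono[OF \<sigma> \<tau>_pages] x(2) by fastforce
    then have "harm (card T) \<le> (\<Sum>x\<in>T. missing_prob M a (?\<sigma> @ \<tau>) x)"
      using \<tau>(3) m by (simp add: sum.remove[OF fin x(1)] harm_Suc inverse_eq_divide)
    moreover have "c T # \<tau> \<in> lists (c ` {U. U \<subseteq> T \<and> y \<in> U})"
    proof -
      have "\<tau> \<in> lists (c ` {U. U \<subseteq> T \<and> y \<in> U})"
        using \<tau>(2) by (rule subsetD[OF lists_mono, rotated]) (intro image_mono, auto)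
      then show ?thesis
        using \<tau>(1) by simp
    qed
    ultimately show ?thesis
      using \<tau>(1) by (intro exI[of _ "c T # \<tau>"] exI[of _ y]) simp
  qed
qed

text \<open>Requesting \<open>xs\<close> first has every page of \<open>A\<close> fetched, so each
  missing one has been paid for; the chain then costs the algorithm \<open>harm (card A)\<close>
  against an optimum of at most 1.\<close>

lemma blocking_competitive_ge_harm:
  fixes M :: "'p paging_instance \<Rightarrow> 'w measure"
  assumes "A \<noteq> {}" "0 \<le> \<rho>"
    and "randomized_alg zero_one_instances M alg" "randomized_competitive zero_one_instances \<rho> M alg"
  shows "harm (card A) \<le> \<rho>"
proof -
  let ?I = "blocking_instance A c"
  have I: "?I \<in> zero_one_instances"
    by (rule blocking_zero_one)
  have "nonlinear_paging ?I"
    using I by (simp add: zero_one_instances_def)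
  then interpret randomized_policy "M ?I" ?I "alg ?I"
    using I assms(3) unfolding randomized_policy_def randomized_policy_axioms_def randomized_alg_def
    by blast
  obtain xs where xs: "set xs = A"
    using finite_A finite_list by blast
  obtain \<tau> y where \<tau>: "y \<in> A" "\<tau> \<in> lists (c ` {U. U \<subseteq> A \<and> y \<in> U})"
    "harm (card A) \<le> (\<Sum>x\<in>A. missing_prob (M ?I) (alg ?I) (xs @ \<tau>) x)"
    using blocking_chain[OF randomized_policy_axioms order_refl assms(1), of xs] xs by auto
  have \<sigma>: "xs @ \<tau> \<in> lists (pages ?I)"
    using xs lists_mono[OF blockers_subset_pages[OF order_refl, of y]] \<tau>(2) by auto
  note \<tau>(3)
  also have "(\<Sum>x\<in>A. missing_prob (M ?I) (alg ?I) (xs @ \<tau>) x)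
      \<le> (\<integral>\<omega>. schedule_cost ?I (xs @ \<tau>) (run (alg ?I \<omega>) (xs @ \<tau>)) \<partial>M ?I)"
    using xs by (intro expected_cost_ge[OF \<sigma>]) auto
  also have "\<dots> \<le> \<rho> * opt_cost ?I (xs @ \<tau>)"
    using assms(4) I \<sigma> unfolding randomized_competitive_def by blast
  also have "\<dots> \<le> \<rho>"
    using mult_left_mono[OF blocking_opt_cost_le_1[OF xs \<tau>(1,2)] assms(2)] by simp
  finally show ?thesis .
qed

end

text \<open>An infinite type has room for \<open>n\<close> pages and a disjoint set of
  \<open>2 ^ n\<close> blockers; any bijection from \<open>Pow A\<close> onto the latter serves as
  \<open>c\<close>.\<close>

lemma exists_blocking:
  assumes "infinite (UNIV :: 'p set)"
  shows "\<exists>(A :: 'p set) c. card A = n \<and> blocking A c"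
proof -
  obtain A :: "'p set" where A: "finite A" "card A = n"
    using infinite_arbitrarily_large[OF assms] by blast
  obtain B where B: "finite B" "card B = card (Pow A)" "B \<subseteq> - A"
    using infinite_arbitrarily_large[of "- A"] A(1) assms by (metis Compl_eq_Diff_UNIV finite_Diff2)
  obtain c where "bij_betw c (Pow A) B"
    using finite_same_card_bij[of "Pow A" B] A(1) B by auto
  then have "blocking A c"
    using A(1) B(3) by unfold_locales (auto simp: bij_betw_def)
  then show ?thesis
    using A(2) by blast
qed

section \<open>No competitive algorithm\<close>

lemma not_randomized_competitive:
  fixes M :: "'p paging_instance \<Rightarrow> 'w measure"
  assumes "infinite (UNIV :: 'p set)" "0 \<le> \<rho>"
    and "randomized_alg zero_one_instances M alg"
  shows "\<not> randomized_competitive zero_one_instances \<rho> M alg"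
proof
  assume comp: "randomized_competitive zero_one_instances \<rho> M alg"
  \<comment> \<open>The harmonic numbers diverge.\<close>
  obtain n where n: "\<rho> < harm n"
    using harm_at_top unfolding filterlim_at_top_dense
    by (meson eventually_happens trivial_limit_sequentially)
  obtain A :: "'p set" and c where A: "card A = n" "blocking A c"
    using exists_blocking[OF assms(1)] by blast
  \<comment> \<open>\<open>harm 0 = 0\<close> does not exceed the nonnegative
    \<open>\<rho>\<close>.\<close>
  have "A \<noteq> {}"
    using n assms(2) A(1) by (auto simp: harm_def)
  then have "harm n \<le> \<rho>"
    using blocking.blocking_competitive_ge_harm[OF A(2) _ assms(2,3) comp] A(1) by simp
  with n show False
    by simp
qed

text \<open>A point mass and a policy ignoring its seed make the expected cost the deterministic
  cost. Any seed type works, since \<open>undefined\<close> inhabits it.\<close>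

lemma randomized_of_deterministic:
  assumes "deterministic_alg C A" "deterministic_competitive C \<rho> A"
  defines "M \<equiv> \<lambda>_. return (count_space UNIV) undefined"
  shows "randomized_alg C M (\<lambda>I _. A I)" "randomized_competitive C \<rho> M (\<lambda>I _. A I)"
proof -
  have M: "prob_space (M I)" for I
    unfolding M_def by (rule prob_space_return) simp
  \<comment> \<open>A constant map is measurable once its value lies in the target space
    \<open>Pow (pages I)\<close>.\<close>
  have "A I \<sigma> \<subseteq> pages I" if "I \<in> C" "\<sigma> \<in> lists (pages I)" for I \<sigma>
    using online_policy_subset[of I "A I" \<sigma>] assms(1) that by (auto simp: deterministic_alg_def)
  then show "randomized_alg C M (\<lambda>I _. A I)"
    using assms(1) M by (auto simp: randomized_alg_def deterministic_alg_def)
  show "randomized_competitive C \<rho> M (\<lambda>I _. A I)"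
    using assms(2) prob_space.prob_space[OF M]
    by (auto simp: randomized_competitive_def deterministic_competitive_def)
qed

theorem theoremA1:
  fixes \<rho> :: real
  assumes "infinite (UNIV :: 'p set)"
    and "\<rho> \<ge> 1"
  shows "\<not> (\<exists>A :: 'p paging_instance \<Rightarrow> 'p list \<Rightarrow> 'p set.
              deterministic_alg zero_one_instances A \<and>
              deterministic_competitive zero_one_instances \<rho> A)
       \<and> \<not> (\<exists>(M :: 'p paging_instance \<Rightarrow> 'w measure) (A :: 'p paging_instance \<Rightarrow> 'w \<Rightarrow> 'p list \<Rightarrow> 'p set).
              randomized_alg zero_one_instances M A \<and>
              randomized_competitive zero_one_instances \<rho> M A)"
  using not_randomized_competitive[OF assms(1), of \<rho>] assms(2) randomized_of_deterministic
  by (metis order_trans zero_le_one)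

end
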